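(* The pair $(\mathsf{comp},\mathsf{iar})$ is symmetric on separable permutations; that is, for every $n\ge1$ the pairs $(\mathsf{comp},\mathsf{iar})$ and $(\mathsf{iar},\mathsf{comp})$ have the same joint distribution over $\mathfrak{S}_n(2413,3142)$.
   Context: $\mathfrak{S}_n$ is the set of permutations $\pi=\pi(1)\cdots\pi(n)$ of $[n]=\{1,\dots,n\}$. A permutation $\pi\in\mathfrak{S}_n$ contains the pattern $\sigma\in\mathfrak{S}_k$ if there are $j_1<\cdots<j_k$ such that $\pi(j_a)<\pi(j_b)$ if and only if $\sigma(a)<\sigma(b)$ for all $1\le a<b\le k$; otherwise it avoids $\sigma$. $\mathfrak{S}_n(2413,3142)$ is the set of permutations in $\mathfrak{S}_n$ avoiding both $2413$ and $3142$; these are the separable permutations. $\mathsf{iar}(\pi)$ is the length of the initial ascending run of $\pi$, i.e. the smallest $i\in[n-1]$ with $\pi(i)>\pi(i+1)$, or $n$ if there is no such $i$. $\mathsf{comp}(\pi)=|\{i\in[n]:\pi(j)\le i\text{ for all }j\le i\}|$. Two pairs of statistics have the same joint distribution over a finite set if each pair of values is attained by the same number of elements under both. *)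

theory Defs
  imports "HOL-Combinatorics.Permutations"
begin

text \<open>A permutation of \<open>{1..n}\<close> is a function \<open>p\<close> with \<open>p permutes {1..n}\<close>; such a function is the
  identity outside \<open>{1..n}\<close>, so equality of functions is equality of permutations.\<close>

definition one_line :: "nat list \<Rightarrow> nat \<Rightarrow> nat" where
  "one_line w i = (if i \<in> {1..length w} then w ! (i - 1) else i)"

definition contains_pattern :: "nat \<Rightarrow> (nat \<Rightarrow> nat) \<Rightarrow> nat \<Rightarrow> (nat \<Rightarrow> nat) \<Rightarrow> bool" where
  "contains_pattern n \<pi> k \<sigma> \<longleftrightarrow>
     (\<exists>j. strict_mono_on {1..k} j \<and> j ` {1..k} \<subseteq> {1..n} \<and>
          (\<forall>a b. 1 \<le> a \<and> a < b \<and> b \<le> k \<longrightarrow> (\<pi> (j a) < \<pi> (j b) \<longleftrightarrow> \<sigma> a < \<sigma> b)))"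

definition separable_perms :: "nat \<Rightarrow> (nat \<Rightarrow> nat) set" where
  "separable_perms n =
     {\<pi>. \<pi> permutes {1..n} \<and>
          \<not> contains_pattern n \<pi> 4 (one_line [2, 4, 1, 3]) \<and>
          \<not> contains_pattern n \<pi> 4 (one_line [3, 1, 4, 2])}"

definition iar :: "nat \<Rightarrow> (nat \<Rightarrow> nat) \<Rightarrow> nat" where
  "iar n \<pi> =
     (if \<exists>i\<in>{1..<n}. \<pi> i > \<pi> (i + 1)
      then LEAST i. i \<in> {1..<n} \<and> \<pi> i > \<pi> (i + 1)
      else n)"

definition num_comp :: "nat \<Rightarrow> (nat \<Rightarrow> nat) \<Rightarrow> nat" where
  "num_comp n \<pi> = card {i \<in> {1..n}. \<forall>j\<in>{1..i}. \<pi> j \<le> i}"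

text \<open>The values may be tuples, which gives equality of joint distributions. Only meaningful for
  finite \<open>S\<close>, since \<open>card\<close> is \<open>0\<close> on infinite sets.\<close>

definition equidistributed_on :: "'a set \<Rightarrow> ('a \<Rightarrow> 'b) \<Rightarrow> ('a \<Rightarrow> 'b) \<Rightarrow> bool" where
  "equidistributed_on S f g \<longleftrightarrow> (\<forall>v. card {x \<in> S. f x = v} = card {x \<in> S. g x = v})"

lemma finite_separable_perms: "finite (separable_perms n)"
  by (rule finite_subset[OF _ finite_permutations[of "{1..n}"]]) (auto simp: separable_perms_def)

end

theory Submission
  imports Defs "HOL-Computational_Algebra.Formal_Power_Series"
begin

text \<open>
  Every nonempty separable permutation is uniquely a direct sum \<open>\<sigma> \<oplus> \<tau>\<close> of an indecomposable
  separable \<open>\<sigma>\<close> (its first component) and an arbitrary separable \<open>\<tau>\<close>, possibly empty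
  (\<open>dsum_bij\<close>). Let \<open>A\<close> and \<open>S\<close> be the generating functions, by size, of the indecomposable and of
  all separable permutations. Then \<open>S = 1 + A S\<close>, and the permutations with \<open>c\<close> components have
  generating function \<open>A\<^sup>c\<close>.

  The second ingredient is reversal. A separable permutation of size at least 2 is a direct sum or
  a skew sum, never both (\<open>separable_splits\<close>, \<open>num_comp_rev_perm\<close>), so reversal exchanges the
  indecomposable permutations of size at least 2 with the decomposable ones. For nonempty \<open>\<tau>\<close> the
  initial run of the reversal of \<open>\<sigma> \<oplus> \<tau>\<close> is that of the reversal of \<open>\<tau>\<close>; splitting off \<open>\<sigma>\<close> and reversing \<open>\<tau>\<close> back shows
  that the indecomposable permutations of size at least 2 with initial run \<open>r \<ge> 1\<close> have generating
  function \<open>A F\<^sub>r\<close>, where \<open>F\<^sub>r\<close> counts all separable permutations with initial run \<open>r\<close>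
  (\<open>gf_nontrivial_indecomposable\<close>). Forgetting the run gives \<open>A = x + A (S - 1)\<close>, that is,
  \<open>x = A (1 - A S)\<close>.

  The initial run of \<open>\<sigma> \<oplus> \<tau>\<close> is that of \<open>\<sigma>\<close>, unless \<open>\<sigma>\<close> is the single point, when it is one more
  than that of \<open>\<tau>\<close>. Hence \<open>F\<^sub>r\<^sub>+\<^sub>1 = x F\<^sub>r + A F\<^sub>r\<^sub>+\<^sub>1 S\<close>, so \<open>(1 - A S) F\<^sub>r\<^sub>+\<^sub>1 = (1 - A S) A F\<^sub>r\<close> and
  \<open>F\<^sub>r = A\<^sup>r\<close>: the run length is distributed like the number of components. Keeping track of both
  statistics, the series \<open>J\<^sub>c\<^sub>,\<^sub>r\<close> of the permutations with \<open>c\<close> components and initial run \<open>r\<close> satisfy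
  \<open>J\<^sub>c\<^sub>+\<^sub>1\<^sub>,\<^sub>r\<^sub>+\<^sub>1 = x J\<^sub>c\<^sub>,\<^sub>r + A F\<^sub>r\<^sub>+\<^sub>1 A\<^sup>c\<close>. The last term is the power of \<open>A\<close> with exponent \<open>c + r + 2\<close>, so
  \<open>J\<^sub>c\<^sub>,\<^sub>r = J\<^sub>r\<^sub>,\<^sub>c\<close> by induction.
\<close>

unbundle fps_syntax

\<comment> \<open>Keeps intervals in the form \<open>{1..n}\<close> during simplification.\<close>
declare One_nat_def [simp del]

section \<open>Separability by positions\<close>

lemma contains_pattern_4_iff:
  "contains_pattern n \<pi> 4 \<sigma> \<longleftrightarrow>
     (\<exists>a b c d. 1 \<le> a \<and> a < b \<and> b < c \<and> c < d \<and> d \<le> n \<and>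
        (\<pi> a < \<pi> b \<longleftrightarrow> \<sigma> 1 < \<sigma> 2) \<and> (\<pi> a < \<pi> c \<longleftrightarrow> \<sigma> 1 < \<sigma> 3) \<and> (\<pi> a < \<pi> d \<longleftrightarrow> \<sigma> 1 < \<sigma> 4) \<and>
        (\<pi> b < \<pi> c \<longleftrightarrow> \<sigma> 2 < \<sigma> 3) \<and> (\<pi> b < \<pi> d \<longleftrightarrow> \<sigma> 2 < \<sigma> 4) \<and> (\<pi> c < \<pi> d \<longleftrightarrow> \<sigma> 3 < \<sigma> 4))"
    (is "?L \<longleftrightarrow> ?R")
proof
  assume ?L
  then obtain j where mono: "strict_mono_on {1..4} j" and ran: "j ` {1..4} \<subseteq> {1..n}"
    and ord: "\<And>a b. 1 \<le> a \<Longrightarrow> a < b \<Longrightarrow> b \<le> 4 \<Longrightarrow> \<pi> (j a) < \<pi> (j b) \<longleftrightarrow> \<sigma> a < \<sigma> b"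
    unfolding contains_pattern_def by auto
  have "j 1 < j 2" "j 2 < j 3" "j 3 < j 4"
    using mono by (auto simp: strict_mono_on_def)
  moreover have "j 1 \<in> {1..n}" "j 4 \<in> {1..n}"
    using ran by (auto simp: image_subset_iff)
  ultimately show ?R
    by (intro exI[of _ "j 1"] exI[of _ "j 2"] exI[of _ "j 3"] exI[of _ "j 4"])
       (simp add: ord)
next
  assume ?R
  then obtain a b c d where *: "1 \<le> a" "a < b" "b < c" "c < d" "d \<le> n"
    "\<pi> a < \<pi> b \<longleftrightarrow> \<sigma> 1 < \<sigma> 2" "\<pi> a < \<pi> c \<longleftrightarrow> \<sigma> 1 < \<sigma> 3" "\<pi> a < \<pi> d \<longleftrightarrow> \<sigma> 1 < \<sigma> 4"
    "\<pi> b < \<pi> c \<longleftrightarrow> \<sigma> 2 < \<sigma> 3" "\<pi> b < \<pi> d \<longleftrightarrow> \<sigma> 2 < \<sigma> 4" "\<pi> c < \<pi> d \<longleftrightarrow> \<sigma> 3 < \<sigma> 4"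
    by blast
  define j :: "nat \<Rightarrow> nat" where
    "j i = (if i = 1 then a else if i = 2 then b else if i = 3 then c else d)" for i
  have j: "j 1 = a" "j 2 = b" "j 3 = c" "j 4 = d" by (simp_all add: j_def)
  have "x < y \<Longrightarrow> x \<in> {1..4} \<Longrightarrow> y \<in> {1..4} \<Longrightarrow>
      (x, y) \<in> {(1,2),(1,3),(1,4),(2,3),(2,4),(3,4)}" for x y :: nat
    by auto
  then have cases: "x < y \<Longrightarrow> 1 \<le> x \<Longrightarrow> y \<le> 4 \<Longrightarrow>
      (x, y) \<in> {(1,2),(1,3),(1,4),(2,3),(2,4),(3,4)}" for x y :: nat
    by (meson atLeastAtMost_iff less_imp_le_nat order_trans)
  have "strict_mono_on {1..4} j"
  proof (rule strict_mono_onI)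
    fix x y :: nat assume "x \<in> {1..4}" "y \<in> {1..4}" "x < y"
    then have "(x, y) \<in> {(1,2),(1,3),(1,4),(2,3),(2,4),(3,4)}" using cases[of x y] by simp
    then show "j x < j y" by (elim insertE emptyE Pair_inject) (use *(1-5) in \<open>simp_all add: j_def\<close>)
  qed
  moreover have "j ` {1..4} \<subseteq> {1..n}"
    using *(1-5) by (auto simp: j_def)
  moreover have "\<pi> (j x) < \<pi> (j y) \<longleftrightarrow> \<sigma> x < \<sigma> y" if "1 \<le> x" "x < y" "y \<le> 4" for x y
    using cases[OF that(2,1,3)] by (elim insertE emptyE Pair_inject) (simp_all only: j *(6-))
  ultimately show ?L
    unfolding contains_pattern_def by blast
qed

text \<open>The values may lie in any linear order, so that the splitting argument can be applied to the
  complement \<open>- f\<close> of a sequence; complementation swaps the two patterns.\<close>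

definition avoids_2413_3142 :: "nat \<Rightarrow> (nat \<Rightarrow> 'a::linorder) \<Rightarrow> bool" where
  "avoids_2413_3142 n f \<longleftrightarrow>
     (\<forall>a b c d. 1 \<le> a \<longrightarrow> a < b \<longrightarrow> b < c \<longrightarrow> c < d \<longrightarrow> d \<le> n \<longrightarrow>
        \<not> (f c < f a \<and> f a < f d \<and> f d < f b) \<and> \<not> (f b < f d \<and> f d < f a \<and> f a < f c))"

lemma separable_perms_iff:
  "\<pi> \<in> separable_perms n \<longleftrightarrow> \<pi> permutes {1..n} \<and> avoids_2413_3142 n \<pi>"
proof -
  have "\<not> contains_pattern n \<pi> 4 (one_line [2, 4, 1, 3]) \<and>
        \<not> contains_pattern n \<pi> 4 (one_line [3, 1, 4, 2]) \<longleftrightarrow> avoids_2413_3142 n \<pi>"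
    if "inj \<pi>"
  proof -
    have less: "\<not> \<pi> x < \<pi> y \<longleftrightarrow> \<pi> y < \<pi> x" if "x < y" for x y
      using \<open>inj \<pi>\<close> that by (metis injD linorder_less_linear order_less_asym)
    have A: "contains_pattern n \<pi> 4 (one_line [2, 4, 1, 3]) \<longleftrightarrow>
        (\<exists>a b c d. 1 \<le> a \<and> a < b \<and> b < c \<and> c < d \<and> d \<le> n \<and> \<pi> c < \<pi> a \<and> \<pi> a < \<pi> d \<and> \<pi> d < \<pi> b)"
      unfolding contains_pattern_4_iff
      by (rule iff_exI)+ (auto simp: one_line_def nth_Cons' less)
    have B: "contains_pattern n \<pi> 4 (one_line [3, 1, 4, 2]) \<longleftrightarrow>
        (\<exists>a b c d. 1 \<le> a \<and> a < b \<and> b < c \<and> c < d \<and> d \<le> n \<and> \<pi> b < \<pi> d \<and> \<pi> d < \<pi> a \<and> \<pi> a < \<pi> c)"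
      unfolding contains_pattern_4_iff
      by (rule iff_exI)+ (auto simp: one_line_def nth_Cons' less)
    show ?thesis
      unfolding A B avoids_2413_3142_def by blast
  qed
  then show ?thesis
    unfolding separable_perms_def by (auto dest: permutes_inj)
qed

section \<open>Splitting a separable permutation\<close>

text \<open>The sequence \<open>f 1, \<dots>, f n\<close> falls into two nonempty parts, all of the first below all of the second.
  For a permutation this says that it is a direct sum; for \<open>- f\<close> in place of \<open>f\<close>, a skew sum.\<close>

definition splits_at :: "nat \<Rightarrow> (nat \<Rightarrow> 'a::linorder) \<Rightarrow> nat \<Rightarrow> bool" where
  "splits_at n f m \<longleftrightarrow> m \<in> {1..<n} \<and> (\<forall>i\<in>{1..m}. \<forall>j\<in>{Suc m..n}. f i < f j)"

text \<open>Let the initial part of the split be as short as possible and append a last value \<open>v\<close>. If \<open>v\<close> exceeds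
  the whole initial part, the old split survives; if \<open>v\<close> is a new minimum, the last entry splits off
  as a skew summand. Otherwise some values of the initial part lie above \<open>v\<close> and some below. An entry
  above \<open>v\<close> followed there by one below \<open>v\<close>, then by any entry of the second part and by \<open>v\<close>, would
  form 3142. So in the initial part all entries below \<open>v\<close> precede all those above, which splits the
  sequence at an earlier place, against minimality.\<close>

lemma split_extends_by_last:
  fixes f :: "nat \<Rightarrow> int"
  assumes inj: "inj_on f {1..Suc n}" and av: "avoids_2413_3142 (Suc n) f"
    and split: "splits_at n f m0"
  shows "\<exists>m. splits_at (Suc n) f m \<or> splits_at (Suc n) (\<lambda>i. - f i) m"
proof -
  define m where "m = (LEAST m. splits_at n f m)"
  have m: "splits_at n f m"
    unfolding m_def using split by (rule LeastI)
  have least: "\<not> splits_at n f m'" if "m' < m" for m'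
    using that unfolding m_def by (rule not_less_Least)
  have mn: "1 \<le> m" "m < n" and sep: "\<And>i j. i \<in> {1..m} \<Longrightarrow> j \<in> {Suc m..n} \<Longrightarrow> f i < f j"
    using m by (auto simp: splits_at_def)
  define v where "v = f (Suc n)"
  have ne: "f i \<noteq> v" if "i \<in> {1..n}" for i
    using inj_onD[OF inj, of i "Suc n"] that by (auto simp: v_def)
  consider (above) "\<forall>i\<in>{1..m}. f i < v" | (below) "\<forall>i\<in>{1..n}. v < f i"
    | (inside) u l where "u \<in> {1..m}" "v < f u" "l \<in> {1..n}" "f l < v"
  proof (cases "\<forall>i\<in>{1..m}. f i < v")
    case False
    then obtain u where u: "u \<in> {1..m}" "\<not> f u < v" by blast
    moreover have "u \<in> {1..n}" using u mn by auto
    ultimately have "v < f u" using ne[of u] by linarith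
    then show ?thesis
      using u that(2,3) ne by (metis linorder_less_linear)
  qed (use that in blast)
  then show ?thesis
  proof cases
    case above
    then have "splits_at (Suc n) f m"
      using mn sep by (auto simp: splits_at_def v_def le_Suc_eq)
    then show ?thesis by blast
  next
    case below
    then have "splits_at (Suc n) (\<lambda>i. - f i) n"
      using mn by (auto simp: splits_at_def v_def le_Suc_eq)
    then show ?thesis by blast
  next
    case inside
    have big: "v < f j" if "j \<in> {Suc m..n}" for j
      using sep[OF inside(1) that] inside(2) by linarith
    \<comment> \<open>Otherwise positions \<open>i\<close>, \<open>l'\<close>, \<open>n\<close>, \<open>n + 1\<close> carry the pattern 3142.\<close>
    have no_inv: "f i < v" if "i \<in> {1..m}" "l' \<in> {1..m}" "i < l'" "f l' < v" for i l'
    proof (rule ccontr)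
      assume "\<not> f i < v"
      moreover have "i \<in> {1..n}" using that mn by auto
      ultimately have "v < f i" using ne[of i] by linarith
      moreover have "f i < f n" using sep[of i n] that mn by auto
      moreover have "\<not> (f l' < f (Suc n) \<and> f (Suc n) < f i \<and> f i < f n)"
        using av[unfolded avoids_2413_3142_def, rule_format, of i l' n "Suc n"] that mn by auto
      ultimately show False using that by (auto simp: v_def)
    qed
    \<comment> \<open>The last position of the initial part with a value below \<open>v\<close>: the split contradicting minimality.\<close>
    define k where "k = Max {i \<in> {1..m}. f i < v}"
    have l: "l \<in> {i \<in> {1..m}. f i < v}"
      using big[of l] inside by force
    have "k \<in> {i \<in> {1..m}. f i < v}"
      unfolding k_def using l by (intro Max_in) auto
    then have k: "k \<in> {1..m}" "f k < v" by auto
    have k_max: "\<not> f i < v" if "i \<in> {Suc k..m}" for i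
    proof
      assume "f i < v"
      then have "i \<le> k" unfolding k_def using that by (intro Max_ge) auto
      then show False using that by auto
    qed
    have lo: "f i < v" if "i \<in> {1..k}" for i
      using no_inv[of i k] k that by (cases "i = k") auto
    have hi: "v < f j" if "j \<in> {Suc k..n}" for j
      using k_max[of j] big[of j] ne[of j] that k by (cases "j \<le> m") force+
    have "k < m"
      using lo[of u] inside k by (cases "k = m") auto
    then have "splits_at n f k"
      using less_trans[OF lo hi] k(1) mn \<open>k < m\<close> unfolding splits_at_def by simp
    then show ?thesis using least \<open>k < m\<close> by blast
  qed
qed

text \<open>Induction on \<open>n\<close>: the prefix of length \<open>n - 1\<close> splits directly or skewly, and the second case is the
  first one for \<open>- f\<close>.\<close>

lemma separable_splits:
  fixes f :: "nat \<Rightarrow> int"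
  assumes "n \<ge> 2" "inj_on f {1..n}" "avoids_2413_3142 n f"
  shows "\<exists>m. splits_at n f m \<or> splits_at n (\<lambda>i. - f i) m"
  using assms
proof (induction n rule: nat_induct_at_least)
  case base
  have "f 1 \<noteq> f 2" using inj_onD[OF base.prems(1), of 1 2] by auto
  then have "splits_at 2 f 1 \<or> splits_at 2 (\<lambda>i. - f i) 1"
    by (auto simp: splits_at_def numeral_2_eq_2)
  then show ?case by blast
next
  case (Suc n)
  have av: "avoids_2413_3142 n f"
    using Suc.prems(2) unfolding avoids_2413_3142_def by (meson le_SucI)
  have "inj_on f {1..n}"
    using Suc.prems(1) by (rule inj_on_subset) auto
  with Suc.IH av obtain m where "splits_at n f m \<or> splits_at n (\<lambda>i. - f i) m" by blast
  then show ?case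
  proof
    assume "splits_at n f m"
    with Suc.prems show ?thesis by (rule split_extends_by_last)
  next
    assume *: "splits_at n (\<lambda>i. - f i) m"
    have "inj_on (\<lambda>i. - f i) {1..Suc n}"
      using Suc.prems(1) by (auto simp: inj_on_def)
    moreover have "avoids_2413_3142 (Suc n) (\<lambda>i. - f i)"
      using Suc.prems(2) unfolding avoids_2413_3142_def neg_less_iff_less by blast
    ultimately show ?thesis
      using split_extends_by_last[OF _ _ *] by auto
  qed
qed

section \<open>Direct sums\<close>

text \<open>Permutations are the identity outside \<open>{1..n}\<close>, so the size of the second summand need not be a
  parameter.\<close>

definition dsum :: "nat \<Rightarrow> (nat \<Rightarrow> nat) \<Rightarrow> (nat \<Rightarrow> nat) \<Rightarrow> nat \<Rightarrow> nat" where
  "dsum m \<sigma> \<tau> i = (if i \<le> m then \<sigma> i else \<tau> (i - m) + m)"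

definition is_cut :: "(nat \<Rightarrow> nat) \<Rightarrow> nat \<Rightarrow> bool" where
  "is_cut \<pi> i \<longleftrightarrow> (\<forall>j\<in>{1..i}. \<pi> j \<le> i)"

lemma num_comp_eq: "num_comp n \<pi> = card {i \<in> {1..n}. is_cut \<pi> i}"
  by (simp add: num_comp_def is_cut_def)

lemma permutes_in_range: "\<pi> permutes {1..n} \<Longrightarrow> 1 \<le> i \<Longrightarrow> i \<le> n \<Longrightarrow> 1 \<le> \<pi> i \<and> \<pi> i \<le> n"
  for \<pi> :: "nat \<Rightarrow> nat"
  using permutes_in_image[of \<pi> "{1..n}" i] by auto

lemma permutes_outside: "\<pi> permutes {1..n} \<Longrightarrow> \<not> (1 \<le> i \<and> i \<le> n) \<Longrightarrow> \<pi> i = i"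
  for \<pi> :: "nat \<Rightarrow> nat"
  using permutes_not_in[of \<pi> "{1..n}" i] by auto

lemma is_cut_image:
  assumes "\<pi> permutes {1..n}" "m \<le> n" "is_cut \<pi> m"
  shows "\<pi> ` {1..m} = {1..m}"
proof (rule card_subset_eq)
  show "\<pi> ` {1..m} \<subseteq> {1..m}"
    using assms permutes_in_range[OF assms(1)] by (fastforce simp: is_cut_def)
  show "card (\<pi> ` {1..m}) = card {1..m}"
    using permutes_inj[OF assms(1)] by (simp add: card_image inj_on_subset)
qed auto

lemma is_cut_greater:
  assumes "\<pi> permutes {1..n}" "m \<le> n" "is_cut \<pi> m" "m < i"
  shows "m < \<pi> i"
proof (rule ccontr)
  assume "\<not> m < \<pi> i"
  moreover have "1 \<le> \<pi> i"
    using permutes_in_range[OF assms(1), of i] permutes_outside[OF assms(1), of i] assms(4)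
    by (cases "i \<le> n") auto
  ultimately have "\<pi> i \<in> \<pi> ` {1..m}" using is_cut_image[OF assms(1-3)] by auto
  then have "i \<in> {1..m}" using permutes_inj[OF assms(1)] by (simp add: inj_image_mem_iff)
  then show False using assms(4) by simp
qed

lemma is_cut_full: "\<pi> permutes {1..n} \<Longrightarrow> is_cut \<pi> n"
  using permutes_in_range[of \<pi> n] by (auto simp: is_cut_def)

text \<open>Backwards, for \<open>i \<le> m\<close> the \<open>n - m\<close> values after position \<open>m\<close> all lie in \<open>{\<pi> i + 1..n}\<close>, so there are
  at most \<open>n - \<pi> i\<close> of them and \<open>\<pi> i \<le> m\<close>.\<close>

lemma is_cut_iff_splits_at:
  assumes "\<pi> permutes {1..n}" "m \<in> {1..<n}"
  shows "is_cut \<pi> m \<longleftrightarrow> splits_at n \<pi> m"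
proof
  assume c: "is_cut \<pi> m"
  have "\<pi> i < \<pi> j" if "i \<in> {1..m}" "j \<in> {Suc m..n}" for i j
    using is_cut_greater[OF assms(1) _ c, of j] that assms(2) c unfolding is_cut_def
    by (metis Suc_le_eq atLeastAtMost_iff atLeastLessThan_iff less_imp_le_nat order_le_less_trans)
  then show "splits_at n \<pi> m" using assms(2) by (simp add: splits_at_def)
next
  assume s: "splits_at n \<pi> m"
  show "is_cut \<pi> m" unfolding is_cut_def
  proof
    fix i assume i: "i \<in> {1..m}"
    have "\<pi> ` {Suc m..n} \<subseteq> {Suc (\<pi> i)..n}"
      using s i permutes_in_range[OF assms(1)] by (force simp: splits_at_def Suc_le_eq)
    then have "card (\<pi> ` {Suc m..n}) \<le> card {Suc (\<pi> i)..n}"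
      by (intro card_mono) auto
    moreover have "card (\<pi> ` {Suc m..n}) = n - m"
      using permutes_inj[OF assms(1)] by (simp add: card_image inj_on_subset)
    ultimately have "n - m \<le> n - \<pi> i" by simp
    moreover have "m < n" using assms(2) by simp
    ultimately show "\<pi> i \<le> m" by linarith
  qed
qed

lemma dsum_permutes:
  assumes "\<sigma> permutes {1..m}" "\<tau> permutes {1..k}"
  shows "dsum m \<sigma> \<tau> permutes {1..m + k}"
proof (rule bij_imp_permutes)
  show "dsum m \<sigma> \<tau> x = x" if "x \<notin> {1..m + k}" for x
    using that permutes_outside[OF assms(1), of x] permutes_outside[OF assms(2), of "x - m"]
    by (auto simp: dsum_def Suc_le_eq One_nat_def)
  have le: "\<sigma> i \<le> m" if "i \<le> m" for i
    using permutes_in_range[OF assms(1), of i] permutes_outside[OF assms(1), of i] that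
    by (cases "i = 0") auto
  have pos: "0 < \<tau> i" if "0 < i" for i
    using permutes_in_range[OF assms(2), of i] permutes_outside[OF assms(2), of i] that
    by (cases "i \<le> k") auto
  have "inj_on (dsum m \<sigma> \<tau>) {1..m + k}"
  proof (rule inj_onI)
    fix x y assume "x \<in> {1..m + k}" "y \<in> {1..m + k}" "dsum m \<sigma> \<tau> x = dsum m \<sigma> \<tau> y"
    then show "x = y"
      using le[of x] le[of y] pos[of "x - m"] pos[of "y - m"]
        injD[OF permutes_inj[OF assms(1)], of x y] injD[OF permutes_inj[OF assms(2)], of "x - m" "y - m"]
      by (auto simp: dsum_def split: if_splits)
  qed
  moreover have "dsum m \<sigma> \<tau> ` {1..m + k} \<subseteq> {1..m + k}"
  proof (clarify)
    fix x assume "x \<in> {1..m + k}"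
    then show "dsum m \<sigma> \<tau> x \<in> {1..m + k}"
      using permutes_in_range[OF assms(1), of x] permutes_in_range[OF assms(2), of "x - m"]
      by (cases "x \<le> m") (auto simp: dsum_def Suc_le_eq One_nat_def)
  qed
  ultimately show "bij_betw (dsum m \<sigma> \<tau>) {1..m + k} {1..m + k}"
    by (simp add: bij_betw_def endo_inj_surj)
qed

lemma dsum_is_cut:
  assumes "\<sigma> permutes {1..m}"
  shows "i \<le> m \<Longrightarrow> is_cut (dsum m \<sigma> \<tau>) i \<longleftrightarrow> is_cut \<sigma> i"
    and "is_cut (dsum m \<sigma> \<tau>) (m + i) \<longleftrightarrow> is_cut \<tau> i"
proof -
  show "i \<le> m \<Longrightarrow> is_cut (dsum m \<sigma> \<tau>) i \<longleftrightarrow> is_cut \<sigma> i"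
    by (auto simp: is_cut_def dsum_def)
  show "is_cut (dsum m \<sigma> \<tau>) (m + i) \<longleftrightarrow> is_cut \<tau> i"
  proof
    assume c: "is_cut (dsum m \<sigma> \<tau>) (m + i)"
    show "is_cut \<tau> i" unfolding is_cut_def
    proof
      fix j assume "j \<in> {1..i}"
      then show "\<tau> j \<le> i"
        using c[unfolded is_cut_def, rule_format, of "m + j"] by (auto simp: dsum_def)
    qed
  next
    assume c: "is_cut \<tau> i"
    show "is_cut (dsum m \<sigma> \<tau>) (m + i)" unfolding is_cut_def
    proof
      fix j assume "j \<in> {1..m + i}"
      then show "dsum m \<sigma> \<tau> j \<le> m + i"
        using c[unfolded is_cut_def, rule_format, of "j - m"] permutes_in_range[OF assms, of j]
        by (cases "j \<le> m") (auto simp: dsum_def Suc_le_eq One_nat_def)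
    qed
  qed
qed

lemma num_comp_dsum:
  assumes "\<sigma> permutes {1..m}"
  shows "num_comp (m + k) (dsum m \<sigma> \<tau>) = num_comp m \<sigma> + num_comp k \<tau>"
proof -
  have "{i \<in> {1..m + k}. is_cut (dsum m \<sigma> \<tau>) i}
      = {i \<in> {1..m}. is_cut \<sigma> i} \<union> (+) m ` {i \<in> {1..k}. is_cut \<tau> i}" (is "?L = ?R")
  proof (intro equalityI subsetI)
    fix x assume x: "x \<in> ?L"
    show "x \<in> ?R"
    proof (cases "x \<le> m")
      case True
      then show ?thesis using x dsum_is_cut(1)[OF assms] by auto
    next
      case False
      then have "x = m + (x - m)" by simp
      moreover have "x - m \<in> {i \<in> {1..k}. is_cut \<tau> i}"
        using x False dsum_is_cut(2)[OF assms, of \<tau> "x - m"] by auto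
      ultimately show ?thesis by blast
    qed
  next
    fix x assume "x \<in> ?R"
    then show "x \<in> ?L" using dsum_is_cut[OF assms] by auto
  qed
  moreover have "card \<dots> = card {i \<in> {1..m}. is_cut \<sigma> i} + card ((+) m ` {i \<in> {1..k}. is_cut \<tau> i})"
    by (intro card_Un_disjoint) auto
  ultimately show ?thesis
    by (simp add: num_comp_eq card_image)
qed

text \<open>Neither pattern is itself a direct sum, so no occurrence of one can straddle the two summands.\<close>

lemma avoids_dsum:
  assumes "\<sigma> permutes {1..m}" "\<tau> permutes {1..k}"
  shows "avoids_2413_3142 (m + k) (dsum m \<sigma> \<tau>) \<longleftrightarrow> avoids_2413_3142 m \<sigma> \<and> avoids_2413_3142 k \<tau>"
proof safe
  let ?\<pi> = "dsum m \<sigma> \<tau>"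
  have lo: "?\<pi> i = \<sigma> i" if "i \<le> m" for i using that by (simp add: dsum_def)
  have hi: "?\<pi> (m + i) = m + \<tau> i" if "1 \<le> i" for i using that by (simp add: dsum_def)
  assume av: "avoids_2413_3142 (m + k) ?\<pi>"
  show "avoids_2413_3142 m \<sigma>"
    unfolding avoids_2413_3142_def
  proof (intro allI impI)
    fix a b c d assume "1 \<le> a" "a < b" "b < c" "c < d" "d \<le> m"
    then show "\<not> (\<sigma> c < \<sigma> a \<and> \<sigma> a < \<sigma> d \<and> \<sigma> d < \<sigma> b) \<and> \<not> (\<sigma> b < \<sigma> d \<and> \<sigma> d < \<sigma> a \<and> \<sigma> a < \<sigma> c)"
      using av[unfolded avoids_2413_3142_def, rule_format, of a b c d] by (simp add: lo)
  qed
  show "avoids_2413_3142 k \<tau>"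
    unfolding avoids_2413_3142_def
  proof (intro allI impI)
    fix a b c d assume "1 \<le> a" "a < b" "b < c" "c < d" "d \<le> k"
    then show "\<not> (\<tau> c < \<tau> a \<and> \<tau> a < \<tau> d \<and> \<tau> d < \<tau> b) \<and> \<not> (\<tau> b < \<tau> d \<and> \<tau> d < \<tau> a \<and> \<tau> a < \<tau> c)"
      using av[unfolded avoids_2413_3142_def, rule_format, of "m + a" "m + b" "m + c" "m + d"]
      by (simp add: hi)
  qed
next
  let ?\<pi> = "dsum m \<sigma> \<tau>"
  assume av: "avoids_2413_3142 m \<sigma>" "avoids_2413_3142 k \<tau>"
  have le: "?\<pi> i \<le> m" if "1 \<le> i" "i \<le> m" for i
    using permutes_in_range[OF assms(1), of i] that by (simp add: dsum_def)
  have gt: "m < ?\<pi> i" if "m < i" "i \<le> m + k" for i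
  proof -
    have "1 \<le> i - m" "i - m \<le> k" using that by auto
    then show ?thesis using permutes_in_range[OF assms(2), of "i - m"] that by (simp add: dsum_def)
  qed
  show "avoids_2413_3142 (m + k) ?\<pi>"
    unfolding avoids_2413_3142_def
  proof (intro allI impI)
    fix a b c d assume *: "1 \<le> a" "a < b" "b < c" "c < d" "d \<le> m + k"
    consider "d \<le> m" | "m < a" | "a \<le> m" "m < d" by linarith
    then show "\<not> (?\<pi> c < ?\<pi> a \<and> ?\<pi> a < ?\<pi> d \<and> ?\<pi> d < ?\<pi> b) \<and> \<not> (?\<pi> b < ?\<pi> d \<and> ?\<pi> d < ?\<pi> a \<and> ?\<pi> a < ?\<pi> c)"
    proof cases
      case 1
      then show ?thesis
        using av(1)[unfolded avoids_2413_3142_def, rule_format, of a b c d] * by (simp add: dsum_def)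
    next
      case 2
      then show ?thesis
        using av(2)[unfolded avoids_2413_3142_def, rule_format, of "a - m" "b - m" "c - m" "d - m"] *
        by (simp add: dsum_def)
    next
      case 3
      then show ?thesis
        using * le[of a] le[of b] gt[of d] gt[of c] by (cases "c \<le> m") auto
    qed
  qed
qed

lemma dsum_separable_iff:
  assumes "\<sigma> permutes {1..m}" "\<tau> permutes {1..k}"
  shows "dsum m \<sigma> \<tau> \<in> separable_perms (m + k) \<longleftrightarrow> \<sigma> \<in> separable_perms m \<and> \<tau> \<in> separable_perms k"
  using assms dsum_permutes[OF assms] avoids_dsum[OF assms] by (simp add: separable_perms_iff)

lemma separable_permutes: "\<pi> \<in> separable_perms n \<Longrightarrow> \<pi> permutes {1..n}"
  by (simp add: separable_perms_iff)

definition head :: "nat \<Rightarrow> (nat \<Rightarrow> nat) \<Rightarrow> nat \<Rightarrow> nat" where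
  "head m \<pi> i = (if i \<le> m then \<pi> i else i)"

text \<open>The truncated subtraction gives the correct value 0 at 0, since \<open>\<pi> m \<le> m\<close> at a cut \<open>m\<close>.\<close>

definition tail :: "nat \<Rightarrow> (nat \<Rightarrow> nat) \<Rightarrow> nat \<Rightarrow> nat" where
  "tail m \<pi> i = \<pi> (i + m) - m"

lemma cut_decomposition:
  assumes "\<pi> permutes {1..n}" "m \<le> n" "is_cut \<pi> m"
  shows "head m \<pi> permutes {1..m}" "tail m \<pi> permutes {1..n - m}"
    and "dsum m (head m \<pi>) (tail m \<pi>) = \<pi>"
proof -
  have inj: "inj \<pi>" using assms(1) by (rule permutes_inj)
  have gt: "m < \<pi> i" if "m < i" for i using is_cut_greater[OF assms that] .
  have 0: "\<pi> 0 = 0" using permutes_outside[OF assms(1), of 0] by simp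
  have le: "\<pi> i \<le> m" if "i \<le> m" for i
    using assms(3) that 0 by (cases "i = 0") (auto simp: is_cut_def)
  show "head m \<pi> permutes {1..m}"
  proof (rule bij_imp_permutes)
    have "bij_betw \<pi> {1..m} {1..m}"
      using is_cut_image[OF assms] inj_on_subset[OF inj subset_UNIV] by (auto simp: bij_betw_def)
    then show "bij_betw (head m \<pi>) {1..m} {1..m}"
      by (rule bij_betw_cong[THEN iffD1, rotated]) (auto simp: head_def)
    show "head m \<pi> x = x" if "x \<notin> {1..m}" for x
      using that 0 by (cases "x = 0") (auto simp: head_def)
  qed
  show "tail m \<pi> permutes {1..n - m}"
  proof (rule bij_imp_permutes)
    have "inj_on (tail m \<pi>) {1..n - m}"
    proof (rule inj_onI)
      fix x y assume "x \<in> {1..n - m}" "y \<in> {1..n - m}" "tail m \<pi> x = tail m \<pi> y"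
      then show "x = y"
        using gt[of "x + m"] gt[of "y + m"] injD[OF inj, of "x + m" "y + m"] by (auto simp: tail_def)
    qed
    moreover have "tail m \<pi> ` {1..n - m} \<subseteq> {1..n - m}"
    proof clarify
      fix x assume "x \<in> {1..n - m}"
      then have "1 \<le> x + m" "x + m \<le> n" "m < x + m" using assms(2) by auto
      then have "m < \<pi> (x + m)" "\<pi> (x + m) \<le> n"
        using gt permutes_in_range[OF assms(1)] by blast+
      then show "tail m \<pi> x \<in> {1..n - m}" by (auto simp: tail_def)
    qed
    ultimately show "bij_betw (tail m \<pi>) {1..n - m} {1..n - m}"
      by (simp add: bij_betw_def endo_inj_surj)
    show "tail m \<pi> x = x" if "x \<notin> {1..n - m}" for x
      using that le[of m] permutes_outside[OF assms(1), of "x + m"] assms(2)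
      by (cases "x = 0") (auto simp: tail_def)
  qed
  show "dsum m (head m \<pi>) (tail m \<pi>) = \<pi>"
  proof
    fix i show "dsum m (head m \<pi>) (tail m \<pi>) i = \<pi> i"
      using gt[of i] by (auto simp: dsum_def head_def tail_def)
  qed
qed

definition indecomposables :: "nat \<Rightarrow> (nat \<Rightarrow> nat) set" where
  "indecomposables n = {\<sigma> \<in> separable_perms n. num_comp n \<sigma> = 1}"

definition first_cut :: "(nat \<Rightarrow> nat) \<Rightarrow> nat" where
  "first_cut \<pi> = (LEAST i. 1 \<le> i \<and> is_cut \<pi> i)"

lemma indecomposable_cuts:
  assumes "\<sigma> \<in> indecomposables m"
  shows "1 \<le> m" "i \<in> {1..m} \<Longrightarrow> is_cut \<sigma> i \<longleftrightarrow> i = m"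
proof -
  have perm: "\<sigma> permutes {1..m}" and c: "card {i \<in> {1..m}. is_cut \<sigma> i} = 1"
    using assms by (auto simp: indecomposables_def separable_perms_iff num_comp_eq)
  show "1 \<le> m" using c by (cases m) auto
  then have "m \<in> {i \<in> {1..m}. is_cut \<sigma> i}" using is_cut_full[OF perm] by simp
  with c have "{i \<in> {1..m}. is_cut \<sigma> i} = {m}"
    by (metis card_1_singletonE singletonD)
  then show "i \<in> {1..m} \<Longrightarrow> is_cut \<sigma> i \<longleftrightarrow> i = m" by blast
qed

lemma first_cut_dsum:
  assumes "\<sigma> \<in> indecomposables m"
  shows "first_cut (dsum m \<sigma> \<tau>) = m"
proof -
  have perm: "\<sigma> permutes {1..m}"
    using assms by (simp add: indecomposables_def separable_permutes)
  note cuts = indecomposable_cuts[OF assms]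
  show ?thesis unfolding first_cut_def
  proof (rule Least_equality)
    show "1 \<le> m \<and> is_cut (dsum m \<sigma> \<tau>) m"
      using cuts(1) cuts(2)[of m] dsum_is_cut(1)[OF perm, of m] by simp
    fix y assume "1 \<le> y \<and> is_cut (dsum m \<sigma> \<tau>) y"
    then show "m \<le> y"
      using cuts(2)[of y] dsum_is_cut(1)[OF perm, of y \<tau>] by (cases "y \<le> m") auto
  qed
qed

text \<open>The inverse cuts a permutation at its smallest cut. That the first summand can be recovered from the
  sum rests on \<open>first_cut_dsum\<close>: an indecomposable \<open>\<sigma>\<close> has no cut before its end.\<close>

lemma dsum_bij:
  assumes "1 \<le> n"
  shows "bij_betw (\<lambda>(m, \<sigma>, \<tau>). dsum m \<sigma> \<tau>)
           (SIGMA m:{0..n}. indecomposables m \<times> separable_perms (n - m)) (separable_perms n)"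
proof (rule bij_betw_byWitness[where f' = "\<lambda>\<pi>. (first_cut \<pi>, head (first_cut \<pi>) \<pi>, tail (first_cut \<pi>) \<pi>)"])
  let ?D = "SIGMA m:{0..n}. indecomposables m \<times> separable_perms (n - m)"
  let ?f = "\<lambda>(m, \<sigma>, \<tau>). dsum m \<sigma> \<tau>"
  let ?g = "\<lambda>\<pi>. (first_cut \<pi>, head (first_cut \<pi>) \<pi>, tail (first_cut \<pi>) \<pi>)"
  show "\<forall>a\<in>?D. ?g (?f a) = a"
  proof
    fix a assume "a \<in> ?D"
    then obtain m \<sigma> \<tau> where a: "a = (m, \<sigma>, \<tau>)"
      and A: "\<sigma> \<in> indecomposables m" "\<tau> \<in> separable_perms (n - m)" by blast
    have p: "\<sigma> permutes {1..m}" "\<tau> permutes {1..n - m}"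
      using A
      by (simp_all add: indecomposables_def separable_permutes)
    have "head m (dsum m \<sigma> \<tau>) = \<sigma>"
      using permutes_outside[OF p(1)] by (auto simp: head_def dsum_def)
    moreover have "tail m (dsum m \<sigma> \<tau>) i = \<tau> i" for i
      using permutes_outside[OF p(2), of 0] permutes_outside[OF p(1), of m] permutes_in_range[OF p(1), of m]
      by (cases "i = 0"; cases "m = 0") (simp_all add: tail_def dsum_def)
    ultimately show "?g (?f a) = a"
      using first_cut_dsum[OF A(1)] by (simp add: a fun_eq_iff)
  qed
  show "?f ` ?D \<subseteq> separable_perms n"
  proof clarify
    fix m \<sigma> \<tau> assume "m \<in> {0..n}" "\<sigma> \<in> indecomposables m" "\<tau> \<in> separable_perms (n - m)"
    then show "dsum m \<sigma> \<tau> \<in> separable_perms n"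
      using dsum_separable_iff[of \<sigma> m \<tau> "n - m"] by (simp add: indecomposables_def separable_permutes)
  qed
  have *: "?f (?g \<pi>) = \<pi> \<and> ?g \<pi> \<in> ?D" if "\<pi> \<in> separable_perms n" for \<pi>
  proof -
    have p: "\<pi> permutes {1..n}" using that by (rule separable_permutes)
    define m where "m = first_cut \<pi>"
    have ex: "1 \<le> n \<and> is_cut \<pi> n" using assms is_cut_full[OF p] by simp
    have m: "1 \<le> m" "is_cut \<pi> m" using LeastI[of "\<lambda>i. 1 \<le> i \<and> is_cut \<pi> i", OF ex]
      by (auto simp: m_def first_cut_def)
    have mn: "m \<le> n" using Least_le[of "\<lambda>i. 1 \<le> i \<and> is_cut \<pi> i", OF ex]
      by (auto simp: m_def first_cut_def)
    have least: "\<not> is_cut \<pi> i" if "1 \<le> i" "i < m" for i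
      using not_less_Least[of i "\<lambda>i. 1 \<le> i \<and> is_cut \<pi> i"] that by (auto simp: m_def first_cut_def)
    note d = cut_decomposition[OF p mn m(2)]
    have "head m \<pi> \<in> separable_perms m \<and> tail m \<pi> \<in> separable_perms (n - m)"
      using dsum_separable_iff[OF d(1,2)] d(3) that mn by simp
    moreover have "{i \<in> {1..m}. is_cut (head m \<pi>) i} = {m}"
    proof -
      have "is_cut (head m \<pi>) i \<longleftrightarrow> i = m" if "i \<in> {1..m}" for i
        using dsum_is_cut(1)[OF d(1), of i "tail m \<pi>"] least[of i] that m by (cases "i < m") (auto simp: d(3))
      then show ?thesis using m by auto
    qed
    ultimately show ?thesis
      using d(3) mn by (simp add: indecomposables_def num_comp_eq m_def[symmetric])
  qed
  show "\<forall>a'\<in>separable_perms n. ?f (?g a') = a'" using * by blast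
  show "?g ` separable_perms n \<subseteq> ?D" using * by blast
qed

section \<open>Reversal\<close>

definition rev_perm :: "nat \<Rightarrow> (nat \<Rightarrow> nat) \<Rightarrow> nat \<Rightarrow> nat" where
  "rev_perm n \<pi> i = (if i \<in> {1..n} then \<pi> (Suc n - i) else i)"

lemma rev_perm_rev_perm: "\<pi> permutes {1..n} \<Longrightarrow> rev_perm n (rev_perm n \<pi>) = \<pi>"
  using permutes_outside[of \<pi> n] by (auto simp: rev_perm_def fun_eq_iff Suc_le_eq)

lemma rev_perm_permutes:
  assumes "\<pi> permutes {1..n}"
  shows "rev_perm n \<pi> permutes {1..n}"
proof (rule bij_imp_permutes)
  have r: "Suc n - i \<in> {1..n}" if "i \<in> {1..n}" for i using that by auto
  have "inj_on (rev_perm n \<pi>) {1..n}"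
  proof (rule inj_onI)
    fix x y assume "x \<in> {1..n}" "y \<in> {1..n}" "rev_perm n \<pi> x = rev_perm n \<pi> y"
    then show "x = y"
      using injD[OF permutes_inj[OF assms], of "Suc n - x" "Suc n - y"] by (auto simp: rev_perm_def)
  qed
  moreover have "rev_perm n \<pi> ` {1..n} \<subseteq> {1..n}"
    using r permutes_in_image[OF assms] by (auto simp: rev_perm_def simp del: atLeastAtMost_iff)
  ultimately show "bij_betw (rev_perm n \<pi>) {1..n} {1..n}"
    by (simp add: bij_betw_def endo_inj_surj)
qed (auto simp: rev_perm_def)

lemma rev_perm_separable:
  assumes "\<pi> \<in> separable_perms n"
  shows "rev_perm n \<pi> \<in> separable_perms n"
proof -
  have p: "\<pi> permutes {1..n}" and av: "avoids_2413_3142 n \<pi>"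
    using assms by (simp_all add: separable_perms_iff)
  have "avoids_2413_3142 n (rev_perm n \<pi>)"
    unfolding avoids_2413_3142_def
  proof (intro allI impI)
    fix a b c d assume *: "1 \<le> a" "a < b" "b < c" "c < d" "d \<le> n"
    let ?r = "rev_perm n \<pi>"
    have "1 \<le> Suc n - d" "Suc n - d < Suc n - c" "Suc n - c < Suc n - b" "Suc n - b < Suc n - a"
      "Suc n - a \<le> n" using * by auto
    from av[unfolded avoids_2413_3142_def, rule_format, OF this]
    show "\<not> (?r c < ?r a \<and> ?r a < ?r d \<and> ?r d < ?r b) \<and> \<not> (?r b < ?r d \<and> ?r d < ?r a \<and> ?r a < ?r c)"
      using * by (simp add: rev_perm_def)
  qed
  then show ?thesis
    using rev_perm_permutes[OF p] by (simp add: separable_perms_iff)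
qed

lemma splits_at_rev_perm:
  assumes "m \<in> {1..<n}"
  shows "splits_at n (rev_perm n \<pi>) (n - m) \<longleftrightarrow> (\<forall>i\<in>{1..m}. \<forall>j\<in>{Suc m..n}. \<pi> j < \<pi> i)"
proof -
  have "splits_at n (rev_perm n \<pi>) (n - m) \<longleftrightarrow>
      (\<forall>i\<in>{1..n - m}. \<forall>j\<in>{Suc (n - m)..n}. \<pi> (Suc n - i) < \<pi> (Suc n - j))"
    using assms by (auto simp: splits_at_def rev_perm_def Suc_le_eq)
  also have "\<dots> \<longleftrightarrow> (\<forall>i\<in>{1..m}. \<forall>j\<in>{Suc m..n}. \<pi> j < \<pi> i)"
  proof
    assume H: "\<forall>i\<in>{1..n - m}. \<forall>j\<in>{Suc (n - m)..n}. \<pi> (Suc n - i) < \<pi> (Suc n - j)"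
    show "\<forall>i\<in>{1..m}. \<forall>j\<in>{Suc m..n}. \<pi> j < \<pi> i"
    proof (intro ballI)
      fix i j assume ij: "i \<in> {1..m}" "j \<in> {Suc m..n}"
      then have "Suc n - j \<in> {1..n - m}" "Suc n - i \<in> {Suc (n - m)..n}"
        using assms by auto
      from H[rule_format, OF this] show "\<pi> j < \<pi> i" using ij assms by simp
    qed
  next
    assume H: "\<forall>i\<in>{1..m}. \<forall>j\<in>{Suc m..n}. \<pi> j < \<pi> i"
    show "\<forall>i\<in>{1..n - m}. \<forall>j\<in>{Suc (n - m)..n}. \<pi> (Suc n - i) < \<pi> (Suc n - j)"
    proof (intro ballI)
      fix i j assume ij: "i \<in> {1..n - m}" "j \<in> {Suc (n - m)..n}"
      have "Suc n - j \<in> {1..m}" "Suc n - i \<in> {Suc m..n}"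
        using ij assms by auto
      from H[rule_format, OF this] show "\<pi> (Suc n - i) < \<pi> (Suc n - j)" .
    qed
  qed
  finally show ?thesis .
qed

lemma num_comp_pos:
  assumes "\<pi> permutes {1..n}" "1 \<le> n"
  shows "1 \<le> num_comp n \<pi>"
proof -
  have "n \<in> {i \<in> {1..n}. is_cut \<pi> i}" using assms is_cut_full by simp
  then have "0 < card {i \<in> {1..n}. is_cut \<pi> i}"
    by (subst card_gt_0_iff) auto
  then show ?thesis unfolding num_comp_eq by linarith
qed

lemma num_comp_ge_2_iff:
  assumes "\<pi> permutes {1..n}" "1 \<le> n"
  shows "2 \<le> num_comp n \<pi> \<longleftrightarrow> (\<exists>m. splits_at n \<pi> m)"
proof -
  have "{i \<in> {1..n}. is_cut \<pi> i} = insert n {i \<in> {1..<n}. is_cut \<pi> i}"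
    using assms(2) is_cut_full[OF assms(1)] by auto
  then have "num_comp n \<pi> = Suc (card {i \<in> {1..<n}. is_cut \<pi> i})"
    by (simp add: num_comp_eq)
  then have "2 \<le> num_comp n \<pi> \<longleftrightarrow> {i \<in> {1..<n}. is_cut \<pi> i} \<noteq> {}"
    by (auto simp: numeral_2_eq_2 Suc_le_eq card_gt_0_iff)
  also have "\<dots> \<longleftrightarrow> (\<exists>m\<in>{1..<n}. splits_at n \<pi> m)"
    using is_cut_iff_splits_at[OF assms(1)] by blast
  also have "\<dots> \<longleftrightarrow> (\<exists>m. splits_at n \<pi> m)"
    unfolding splits_at_def by blast
  finally show ?thesis .
qed

text \<open>This is where separability is essential: the equivalence fails for 2413, where
  neither the permutation nor its reversal splits. On the other hand no permutation splits both ways, since one split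
  forces \<open>\<pi> 1 < \<pi> n\<close> and the other \<open>\<pi> n < \<pi> 1\<close>.\<close>

lemma num_comp_rev_perm:
  assumes "\<pi> \<in> separable_perms n" "2 \<le> n"
  shows "num_comp n \<pi> = 1 \<longleftrightarrow> 2 \<le> num_comp n (rev_perm n \<pi>)"
proof -
  have p: "\<pi> permutes {1..n}" and av: "avoids_2413_3142 n \<pi>"
    using assms by (simp_all add: separable_perms_iff)
  have n: "1 \<le> n" using assms by simp
  have R: "(\<exists>m. splits_at n (rev_perm n \<pi>) m) \<longleftrightarrow> (\<exists>m\<in>{1..<n}. \<forall>i\<in>{1..m}. \<forall>j\<in>{Suc m..n}. \<pi> j < \<pi> i)"
  proof
    assume "\<exists>m. splits_at n (rev_perm n \<pi>) m"
    then obtain m where m: "splits_at n (rev_perm n \<pi>) m" by blast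
    then have "n - m \<in> {1..<n}" "n - (n - m) = m" by (auto simp: splits_at_def)
    then show "\<exists>m\<in>{1..<n}. \<forall>i\<in>{1..m}. \<forall>j\<in>{Suc m..n}. \<pi> j < \<pi> i"
      using splits_at_rev_perm[of "n - m" n \<pi>] m by (intro bexI[of _ "n - m"]) simp_all
  next
    assume "\<exists>m\<in>{1..<n}. \<forall>i\<in>{1..m}. \<forall>j\<in>{Suc m..n}. \<pi> j < \<pi> i"
    then show "\<exists>m. splits_at n (rev_perm n \<pi>) m"
      using splits_at_rev_perm[of _ n \<pi>] by blast
  qed
  have "\<exists>m. splits_at n (\<lambda>i. int (\<pi> i)) m \<or> splits_at n (\<lambda>i. - int (\<pi> i)) m"
    using assms(2) av permutes_inj[OF p]
    by (intro separable_splits) (auto simp: inj_on_def inj_def avoids_2413_3142_def)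
  then have "\<exists>m. splits_at n \<pi> m \<or> (m \<in> {1..<n} \<and> (\<forall>i\<in>{1..m}. \<forall>j\<in>{Suc m..n}. \<pi> j < \<pi> i))"
    unfolding splits_at_def by simp
  then have ex: "(\<exists>m. splits_at n \<pi> m) \<or> (\<exists>m\<in>{1..<n}. \<forall>i\<in>{1..m}. \<forall>j\<in>{Suc m..n}. \<pi> j < \<pi> i)"
    by blast
  have "\<pi> 1 < \<pi> n" if "splits_at n \<pi> m" for m
    using that by (auto simp: splits_at_def)
  moreover have "\<pi> n < \<pi> 1" if "m \<in> {1..<n}" "\<forall>i\<in>{1..m}. \<forall>j\<in>{Suc m..n}. \<pi> j < \<pi> i" for m
    using that by auto
  ultimately have "\<not> (\<exists>m. splits_at n \<pi> m) \<longleftrightarrow> (\<exists>m. splits_at n (rev_perm n \<pi>) m)"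
    using ex unfolding R by (meson less_asym)
  then have "\<not> 2 \<le> num_comp n \<pi> \<longleftrightarrow> 2 \<le> num_comp n (rev_perm n \<pi>)"
    using num_comp_ge_2_iff p rev_perm_permutes[OF p] n by blast
  then show ?thesis using num_comp_pos[OF p n] by auto
qed

section \<open>The initial run\<close>

lemma iarI:
  assumes "1 \<le> r" "r \<le> n" "\<And>i. 1 \<le> i \<Longrightarrow> i < r \<Longrightarrow> \<pi> i \<le> \<pi> (Suc i)" "r < n \<Longrightarrow> \<pi> (Suc r) < \<pi> r"
  shows "iar n \<pi> = r"
proof (cases "r = n")
  case True
  then show ?thesis using assms(3)[unfolded Suc_eq_plus1] by (force simp: iar_def)
next
  case False
  then have r: "r \<in> {1..<n} \<and> \<pi> (r + 1) < \<pi> r"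
    using assms(1,2) assms(4)[unfolded Suc_eq_plus1] by simp
  moreover have "(LEAST i. i \<in> {1..<n} \<and> \<pi> i > \<pi> (i + 1)) = r"
  proof (rule Least_equality)
    show "r \<in> {1..<n} \<and> \<pi> r > \<pi> (r + 1)" using r .
    fix y assume "y \<in> {1..<n} \<and> \<pi> y > \<pi> (y + 1)"
    then show "r \<le> y" using assms(3)[unfolded Suc_eq_plus1, of y] by (cases "y < r") auto
  qed
  ultimately show ?thesis unfolding iar_def by auto
qed

lemma iarE:
  assumes "1 \<le> n"
  shows "1 \<le> iar n \<pi>" "iar n \<pi> \<le> n"
    and "\<And>i. 1 \<le> i \<Longrightarrow> i < iar n \<pi> \<Longrightarrow> \<pi> i \<le> \<pi> (Suc i)"
    and "iar n \<pi> < n \<Longrightarrow> \<pi> (Suc (iar n \<pi>)) < \<pi> (iar n \<pi>)"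
proof -
  let ?P = "\<lambda>i. i \<in> {1..<n} \<and> \<pi> i > \<pi> (i + 1)"
  have "1 \<le> iar n \<pi> \<and> iar n \<pi> \<le> n \<and> (\<forall>i. 1 \<le> i \<longrightarrow> i < iar n \<pi> \<longrightarrow> \<pi> i \<le> \<pi> (i + 1)) \<and>
      (iar n \<pi> < n \<longrightarrow> \<pi> (iar n \<pi> + 1) < \<pi> (iar n \<pi>))"
  proof (cases "\<exists>i\<in>{1..<n}. \<pi> i > \<pi> (i + 1)")
    case True
    then have eq: "iar n \<pi> = (LEAST i. ?P i)" by (simp add: iar_def)
    have P: "?P (iar n \<pi>)" unfolding eq by (rule LeastI_ex[of ?P]) (use True in blast)
    moreover have "\<pi> i \<le> \<pi> (i + 1)" if "1 \<le> i" "i < iar n \<pi>" for i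
      using not_less_Least[of i ?P] that P unfolding eq by auto
    ultimately show ?thesis by auto
  next
    case False
    then show ?thesis using assms by (auto simp: iar_def not_less)
  qed
  then show "1 \<le> iar n \<pi>" "iar n \<pi> \<le> n"
    and "\<And>i. 1 \<le> i \<Longrightarrow> i < iar n \<pi> \<Longrightarrow> \<pi> i \<le> \<pi> (Suc i)"
    and "iar n \<pi> < n \<Longrightarrow> \<pi> (Suc (iar n \<pi>)) < \<pi> (iar n \<pi>)" unfolding Suc_eq_plus1 by blast+
qed

lemma iar_0: "iar 0 \<pi> = 0"
  by (simp add: iar_def)

text \<open>An increasing \<open>\<sigma>\<close> would have \<open>\<sigma> 1 = 1\<close>, hence a cut at 1.\<close>

lemma iar_indecomposable:
  assumes "\<sigma> \<in> indecomposables m" "2 \<le> m"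
  shows "iar m \<sigma> < m"
proof (rule ccontr)
  assume "\<not> iar m \<sigma> < m"
  then have eq: "iar m \<sigma> = m" using iarE(2)[of m \<sigma>] assms(2) by simp
  have p: "\<sigma> permutes {1..m}"
    using assms by (simp add: indecomposables_def separable_permutes)
  have step: "\<sigma> i \<le> \<sigma> (Suc i)" if "1 \<le> i" "i < m" for i
    using iarE(3)[of m i, where \<pi> = \<sigma>] eq that by simp
  have mono: "\<sigma> 1 \<le> \<sigma> i" if "1 \<le> i" "i \<le> m" for i
    using that
  proof (induction i rule: nat_induct_at_least)
    case (Suc n)
    then show ?case using step[of n] by simp
  qed simp
  have "1 \<in> \<sigma> ` {1..m}" using permutes_image[OF p] assms(2) by simp
  then have "\<sigma> 1 \<le> 1" using mono by (metis atLeastAtMost_iff imageE)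
  then have "is_cut \<sigma> 1" by (simp add: is_cut_def)
  then show False using indecomposable_cuts(2)[OF assms(1), of 1] assms(2) by simp
qed

lemma iar_dsum_indecomposable:
  assumes "\<sigma> \<in> indecomposables m" "2 \<le> m"
  shows "iar (m + k) (dsum m \<sigma> \<tau>) = iar m \<sigma>"
proof -
  note less = iar_indecomposable[OF assms]
  have m: "1 \<le> m" using assms by simp
  show ?thesis
    using iarE[OF m, where \<pi> = \<sigma>] less by (intro iarI) (simp_all add: dsum_def)
qed

lemma iar_dsum_1:
  assumes "\<sigma> permutes {1..1}" "\<tau> permutes {1..k}"
  shows "iar (1 + k) (dsum 1 \<sigma> \<tau>) = Suc (iar k \<tau>)"
proof (cases "k = 0")
  case True
  then show ?thesis by (simp add: iar_def)
next
  case False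
  then have k: "1 \<le> k" by simp
  have v: "dsum 1 \<sigma> \<tau> 1 = 1" "\<And>i. 1 \<le> i \<Longrightarrow> dsum 1 \<sigma> \<tau> (Suc i) = Suc (\<tau> i)"
    using permutes_in_range[OF assms(1), of 1] by (auto simp: dsum_def)
  show ?thesis
  proof (rule iarI)
    fix i assume i: "1 \<le> i" "i < Suc (iar k \<tau>)"
    show "dsum 1 \<sigma> \<tau> i \<le> dsum 1 \<sigma> \<tau> (Suc i)"
    proof (cases "i = 1")
      case True
      then show ?thesis using v(1) v(2)[of 1] by simp
    next
      case False
      then obtain j where "i = Suc j" "1 \<le> j" using i by (cases i) auto
      then show ?thesis using iarE(3)[OF k, of j, where \<pi> = \<tau>] v(2)[of j] v(2)[of "Suc j"] i by simp
    qed
  next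
    assume "Suc (iar k \<tau>) < 1 + k"
    then show "dsum 1 \<sigma> \<tau> (Suc (Suc (iar k \<tau>))) < dsum 1 \<sigma> \<tau> (Suc (iar k \<tau>))"
      using iarE(1,4)[OF k, of \<tau>] v(2)[of "iar k \<tau>"] v(2)[of "Suc (iar k \<tau>)"] by simp
  qed (use iarE(2)[OF k, of \<tau>] in auto)
qed

text \<open>The reversal begins with the reversal of \<open>\<tau>\<close>, shifted above all values of \<open>\<sigma>\<close>, so its first descent
  comes at the latest where the entries of \<open>\<sigma>\<close> begin.\<close>

lemma iar_rev_dsum:
  assumes "\<sigma> permutes {1..m}" "\<tau> permutes {1..k}" "1 \<le> m" "1 \<le> k"
  shows "iar (m + k) (rev_perm (m + k) (dsum m \<sigma> \<tau>)) = iar k (rev_perm k \<tau>)"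
proof -
  let ?r = "rev_perm (m + k) (dsum m \<sigma> \<tau>)" and ?s = "iar k (rev_perm k \<tau>)"
  have lo: "?r i = m + rev_perm k \<tau> i" if "1 \<le> i" "i \<le> k" for i
    using that by (auto simp: rev_perm_def dsum_def algebra_simps Suc_diff_le)
  have "dsum m \<sigma> \<tau> m \<le> m" using permutes_in_range[OF assms(1), of m] assms by (simp add: dsum_def)
  then have hi: "?r (Suc k) \<le> m" using assms by (simp add: rev_perm_def)
  have pos: "1 \<le> rev_perm k \<tau> k"
    using permutes_in_range[OF rev_perm_permutes[OF assms(2)], of k] assms by simp
  note s = iarE[OF assms(4), where \<pi> = "rev_perm k \<tau>"]
  show ?thesis
  proof (rule iarI)
    show "?r i \<le> ?r (Suc i)" if "1 \<le> i" "i < ?s" for i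
      using s(2) s(3)[of i] that lo[of i] lo[of "Suc i"] by simp
    show "?r (Suc ?s) < ?r ?s"
    proof (cases "?s = k")
      case True
      then show ?thesis using lo[of k] hi pos assms by simp
    next
      case False
      then show ?thesis using s lo[of ?s] lo[of "Suc ?s"] by simp
    qed
  qed (use s(1,2) in auto)
qed

section \<open>Generating functions\<close>

text \<open>The coefficient of \<open>x\<^sup>n\<close> counts the separable permutations of size \<open>n\<close> that satisfy \<open>P n\<close>. Integer
  coefficients make the power series an integral domain, so that factors can be cancelled.\<close>

definition gf :: "(nat \<Rightarrow> (nat \<Rightarrow> nat) \<Rightarrow> bool) \<Rightarrow> int fps" where
  "gf P = Abs_fps (\<lambda>n. int (card {\<pi> \<in> separable_perms n. P n \<pi>}))"

lemma gf_cong: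
  assumes "\<And>n \<pi>. \<pi> \<in> separable_perms n \<Longrightarrow> P n \<pi> \<longleftrightarrow> Q n \<pi>"
  shows "gf P = gf Q"
proof -
  have "{\<pi> \<in> separable_perms n. P n \<pi>} = {\<pi> \<in> separable_perms n. Q n \<pi>}" for n
    using assms by blast
  then show ?thesis by (simp add: gf_def)
qed

lemma gf_split: "gf P = gf (\<lambda>n \<pi>. P n \<pi> \<and> Q n \<pi>) + gf (\<lambda>n \<pi>. P n \<pi> \<and> \<not> Q n \<pi>)"
proof (rule fps_ext)
  fix n
  have "{\<pi> \<in> separable_perms n. P n \<pi>} =
      {\<pi> \<in> separable_perms n. P n \<pi> \<and> Q n \<pi>} \<union> {\<pi> \<in> separable_perms n. P n \<pi> \<and> \<not> Q n \<pi>}"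
    by blast
  moreover have "card \<dots> = card {\<pi> \<in> separable_perms n. P n \<pi> \<and> Q n \<pi>}
      + card {\<pi> \<in> separable_perms n. P n \<pi> \<and> \<not> Q n \<pi>}"
    by (intro card_Un_disjoint) (auto intro: finite_subset[OF _ finite_separable_perms])
  ultimately show "gf P $ n = (gf (\<lambda>n \<pi>. P n \<pi> \<and> Q n \<pi>) + gf (\<lambda>n \<pi>. P n \<pi> \<and> \<not> Q n \<pi>)) $ n"
    by (simp add: gf_def)
qed

lemma gf_rev_perm: "gf (\<lambda>n \<pi>. P n (rev_perm n \<pi>)) = gf P"
proof (rule fps_ext)
  fix n
  have "bij_betw (rev_perm n) {\<pi> \<in> separable_perms n. P n (rev_perm n \<pi>)} {\<pi> \<in> separable_perms n. P n \<pi>}"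
    by (rule bij_betw_byWitness[where f' = "rev_perm n"])
       (auto simp: rev_perm_rev_perm separable_permutes rev_perm_separable)
  then show "gf (\<lambda>n \<pi>. P n (rev_perm n \<pi>)) $ n = gf P $ n"
    by (simp add: gf_def bij_betw_same_card)
qed

lemma num_comp_le: "num_comp n \<pi> \<le> n"
proof -
  have "num_comp n \<pi> \<le> card {1..n}"
    unfolding num_comp_eq by (intro card_mono) auto
  then show ?thesis by simp
qed

lemma num_comp_eq_0_iff: "\<pi> \<in> separable_perms n \<Longrightarrow> num_comp n \<pi> = 0 \<longleftrightarrow> n = 0"
  using num_comp_pos[OF separable_permutes, of \<pi> n] num_comp_le[of n \<pi>] by linarith

lemma iar_eq_0_iff: "iar n \<pi> = 0 \<longleftrightarrow> n = 0"
  using iarE(1)[of n \<pi>] iar_0 by (cases "n = 0") auto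

text \<open>The decomposition \<open>dsum_bij\<close> as a product of power series: a class of nonempty permutations that is
  described by independent conditions on the first component and on the rest. The empty permutation
  has no first component, whence the first assumption.\<close>

lemma gf_dsum:
  assumes "\<And>\<pi>. \<not> Q 0 \<pi>"
    and "\<And>m k \<sigma> \<tau>. \<sigma> \<in> indecomposables m \<Longrightarrow> \<tau> \<in> separable_perms k \<Longrightarrow>
           Q (m + k) (dsum m \<sigma> \<tau>) \<longleftrightarrow> P m \<sigma> \<and> R k \<tau>"
  shows "gf Q = gf (\<lambda>n \<pi>. num_comp n \<pi> = 1 \<and> P n \<pi>) * gf R"
proof (rule fps_ext)
  fix n
  let ?A = "\<lambda>m. {\<sigma> \<in> separable_perms m. num_comp m \<sigma> = 1 \<and> P m \<sigma>}"
  let ?B = "\<lambda>k. {\<tau> \<in> separable_perms k. R k \<tau>}"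
  let ?D = "SIGMA m:{0..n}. indecomposables m \<times> separable_perms (n - m)"
  let ?f = "\<lambda>(m, \<sigma>, \<tau>). dsum m \<sigma> \<tau>"
  have "card {\<pi> \<in> separable_perms n. Q n \<pi>} = (\<Sum>m=0..n. card (?A m) * card (?B (n - m)))"
  proof (cases "n = 0")
    case True
    then show ?thesis using assms(1) num_comp_le[of 0] by auto
  next
    case False
    then have bij: "bij_betw ?f ?D (separable_perms n)" by (intro dsum_bij) simp
    have fin: "finite (?A m)" "finite (?B m)" for m
      by (auto intro: finite_subset[OF _ finite_separable_perms])
    have "bij_betw ?f {x \<in> ?D. Q n (?f x)} {\<pi> \<in> separable_perms n. Q n \<pi>}"
      using bij by (rule bij_betw_Collect) simp
    moreover have "{x \<in> ?D. Q n (?f x)} = (SIGMA m:{0..n}. ?A m \<times> ?B (n - m))"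
    proof -
      have "Q n (dsum m \<sigma> \<tau>) \<longleftrightarrow> P m \<sigma> \<and> R (n - m) \<tau>"
        if "m \<le> n" "\<sigma> \<in> indecomposables m" "\<tau> \<in> separable_perms (n - m)" for m \<sigma> \<tau>
        using assms(2)[OF that(2,3)] that(1) by simp
      then show ?thesis by (auto simp: indecomposables_def)
    qed
    ultimately have "card (SIGMA m:{0..n}. ?A m \<times> ?B (n - m)) = card {\<pi> \<in> separable_perms n. Q n \<pi>}"
      by (simp only: bij_betw_same_card[of ?f])
    then have "card {\<pi> \<in> separable_perms n. Q n \<pi>} = card (SIGMA m:{0..n}. ?A m \<times> ?B (n - m))" ..
    also have "\<dots> = (\<Sum>m=0..n. card (?A m \<times> ?B (n - m)))"
      using fin by (intro card_SigmaI) auto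
    finally show ?thesis by (simp add: card_cartesian_product)
  qed
  then show "gf Q $ n = (gf (\<lambda>n \<pi>. num_comp n \<pi> = 1 \<and> P n \<pi>) * gf R) $ n"
    by (simp add: gf_def fps_mult_nth)
qed

lemma separable_perms_small: "n \<le> 1 \<Longrightarrow> separable_perms n = {id}"
  by (cases "n = 0") (auto simp: separable_perms_iff avoids_2413_3142_def le_Suc_eq One_nat_def)

lemma gf_size_0: "gf (\<lambda>n \<pi>. n = 0) = 1"
  by (rule fps_ext) (auto simp: gf_def separable_perms_small)

lemma gf_trivial_indecomposable: "gf (\<lambda>n \<pi>. num_comp n \<pi> = 1 \<and> n = 1) = fps_X"
proof -
  have "num_comp n \<pi> = 1 \<and> n = 1 \<longleftrightarrow> n = 1" if "\<pi> \<in> separable_perms n" for n \<pi>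
    using num_comp_eq_0_iff[OF that] num_comp_le[of n \<pi>] by auto
  then have "gf (\<lambda>n \<pi>. num_comp n \<pi> = 1 \<and> n = 1) = gf (\<lambda>n \<pi>. n = 1)"
    by (rule gf_cong)
  also have "\<dots> = fps_X"
    by (rule fps_ext) (auto simp: gf_def separable_perms_small)
  finally show ?thesis .
qed

abbreviation indec_gf :: "int fps" where
  "indec_gf \<equiv> gf (\<lambda>n \<pi>. num_comp n \<pi> = 1)"

lemma dsum_num_comp:
  assumes "\<sigma> \<in> indecomposables m"
  shows "num_comp (m + k) (dsum m \<sigma> \<tau>) = Suc (num_comp k \<tau>)"
  using assms num_comp_dsum[of \<sigma> m k \<tau>] by (simp add: indecomposables_def separable_permutes)

lemma gf_size_pos: "gf (\<lambda>n \<pi>. 1 \<le> n) = indec_gf * gf (\<lambda>n \<pi>. True)"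
proof -
  have "gf (\<lambda>n \<pi>. 1 \<le> n) = gf (\<lambda>n \<pi>. num_comp n \<pi> = 1 \<and> True) * gf (\<lambda>n \<pi>. True)"
    by (rule gf_dsum) (use indecomposable_cuts(1) in \<open>auto intro: trans_le_add1\<close>)
  then show ?thesis by simp
qed

lemma gf_num_comp: "gf (\<lambda>n \<pi>. num_comp n \<pi> = c) = indec_gf ^ c"
proof (induction c)
  case 0
  have "gf (\<lambda>n \<pi>. num_comp n \<pi> = 0) = gf (\<lambda>n \<pi>. n = 0)"
    by (rule gf_cong) (rule num_comp_eq_0_iff)
  then show ?case by (simp add: gf_size_0)
next
  case (Suc c)
  have "gf (\<lambda>n \<pi>. num_comp n \<pi> = Suc c)
      = gf (\<lambda>n \<pi>. num_comp n \<pi> = 1 \<and> True) * gf (\<lambda>n \<pi>. num_comp n \<pi> = c)"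
    by (rule gf_dsum) (use num_comp_le[of 0] in \<open>auto simp: dsum_num_comp\<close>)
  then show ?case by (simp add: Suc.IH)
qed

text \<open>Reversal turns the indecomposable permutations of size at least 2 into the sums \<open>\<sigma> \<oplus> \<tau>\<close> with \<open>\<tau>\<close>
  nonempty, and the initial run is read off the reversal of \<open>\<tau>\<close> alone. As \<open>\<tau>\<close> runs over all nonempty
  separable permutations, so does its reversal. The predicate \<open>K\<close> allows the run length to be fixed or
  to be left free.\<close>

lemma gf_nontrivial_indecomposable:
  "gf (\<lambda>n \<pi>. num_comp n \<pi> = 1 \<and> 2 \<le> n \<and> K (iar n \<pi>)) = indec_gf * gf (\<lambda>n \<pi>. 1 \<le> n \<and> K (iar n \<pi>))"
proof -
  let ?Q = "\<lambda>n \<pi>. 2 \<le> num_comp n \<pi> \<and> K (iar n (rev_perm n \<pi>))"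
  let ?R = "\<lambda>n \<pi>. 1 \<le> n \<and> K (iar n (rev_perm n \<pi>))"
  have "gf (\<lambda>n \<pi>. num_comp n \<pi> = 1 \<and> 2 \<le> n \<and> K (iar n \<pi>)) = gf (\<lambda>n \<pi>. ?Q n (rev_perm n \<pi>))"
  proof (rule gf_cong)
    fix n \<pi> assume *: "\<pi> \<in> separable_perms n"
    have "num_comp n \<pi> = 1 \<and> 2 \<le> n \<longleftrightarrow> 2 \<le> num_comp n (rev_perm n \<pi>)"
      using num_comp_rev_perm[OF *] num_comp_le[of n "rev_perm n \<pi>"] by auto
    then show "num_comp n \<pi> = 1 \<and> 2 \<le> n \<and> K (iar n \<pi>) \<longleftrightarrow> ?Q n (rev_perm n \<pi>)"
      using * by (auto simp: rev_perm_rev_perm separable_permutes)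
  qed
  also have "\<dots> = gf ?Q" by (rule gf_rev_perm)
  also have "\<dots> = gf (\<lambda>n \<pi>. num_comp n \<pi> = 1 \<and> True) * gf ?R"
  proof (rule gf_dsum)
    show "\<not> ?Q 0 \<pi>" for \<pi> using num_comp_le[of 0 \<pi>] by simp
    fix m k \<sigma> \<tau> assume *: "\<sigma> \<in> indecomposables m" "\<tau> \<in> separable_perms k"
    have p: "\<sigma> permutes {1..m}" "\<tau> permutes {1..k}"
      using * by (simp_all add: indecomposables_def separable_permutes)
    have "2 \<le> num_comp (m + k) (dsum m \<sigma> \<tau>) \<longleftrightarrow> 1 \<le> k"
      using num_comp_eq_0_iff[OF *(2)] by (auto simp: dsum_num_comp[OF *(1)])
    then show "?Q (m + k) (dsum m \<sigma> \<tau>) \<longleftrightarrow> True \<and> ?R k \<tau>"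
      using iar_rev_dsum[OF p indecomposable_cuts(1)[OF *(1)]] by auto
  qed
  also have "gf ?R = gf (\<lambda>n \<pi>. 1 \<le> n \<and> K (iar n \<pi>))"
    by (rule gf_rev_perm)
  finally show ?thesis by simp
qed

text \<open>The single point, and all larger indecomposables with the run length left free.\<close>

lemma indec_gf_eq: "indec_gf = fps_X + indec_gf * gf (\<lambda>n \<pi>. 1 \<le> n)"
proof -
  have "indec_gf = gf (\<lambda>n \<pi>. num_comp n \<pi> = 1 \<and> n = 1) + gf (\<lambda>n \<pi>. num_comp n \<pi> = 1 \<and> n \<noteq> 1)"
    by (rule gf_split)
  also have "gf (\<lambda>n \<pi>. num_comp n \<pi> = 1 \<and> n = 1) = fps_X"
    by (rule gf_trivial_indecomposable)
  also have "gf (\<lambda>n \<pi>. num_comp n \<pi> = 1 \<and> n \<noteq> 1) = gf (\<lambda>n \<pi>. num_comp n \<pi> = 1 \<and> 2 \<le> n \<and> True)"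
  proof (rule gf_cong)
    fix n \<pi>
    show "num_comp n \<pi> = 1 \<and> n \<noteq> 1 \<longleftrightarrow> num_comp n \<pi> = 1 \<and> 2 \<le> n \<and> True"
      using num_comp_le[of n \<pi>] by auto
  qed
  also have "\<dots> = indec_gf * gf (\<lambda>n \<pi>. 1 \<le> n \<and> True)"
    by (rule gf_nontrivial_indecomposable)
  finally show ?thesis unfolding simp_thms .
qed

text \<open>The two summands correspond to a first component of size 1, which contributes one component and one
  step of the run, and to a larger first component, which contains the whole run. The permutations
  with a first component of size 1 are those with \<open>\<pi> 1 = 1\<close>. The predicate \<open>K\<close> is used both for a
  fixed number of components and for no condition at all.\<close>

lemma gf_iar_Suc:
  "gf (\<lambda>n \<pi>. iar n \<pi> = Suc r \<and> K (num_comp n \<pi> - 1)) =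
     fps_X * gf (\<lambda>n \<pi>. iar n \<pi> = r \<and> K (num_comp n \<pi>)) +
     indec_gf * gf (\<lambda>n \<pi>. iar n \<pi> = Suc r) * gf (\<lambda>n \<pi>. K (num_comp n \<pi>))"
proof -
  let ?Q = "\<lambda>n \<pi>. iar n \<pi> = Suc r \<and> K (num_comp n \<pi> - 1)"
  have first: "dsum m \<sigma> \<tau> 1 = 1 \<longleftrightarrow> m = 1" "m = 1 \<or> 2 \<le> m" if "\<sigma> \<in> indecomposables m" for m \<sigma> \<tau>
  proof -
    have p: "\<sigma> permutes {1..m}" using that by (simp add: indecomposables_def separable_permutes)
    note c = indecomposable_cuts[OF that]
    show "m = 1 \<or> 2 \<le> m" using c(1) by auto
    have "is_cut \<sigma> 1 \<longleftrightarrow> \<sigma> 1 = 1"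
      using permutes_in_range[OF p, of 1] c(1) by (auto simp: is_cut_def)
    then show "dsum m \<sigma> \<tau> 1 = 1 \<longleftrightarrow> m = 1" using c(1) c(2)[of 1] by (auto simp: dsum_def)
  qed
  have "gf ?Q = gf (\<lambda>n \<pi>. ?Q n \<pi> \<and> \<pi> 1 = 1) + gf (\<lambda>n \<pi>. ?Q n \<pi> \<and> \<pi> 1 \<noteq> 1)"
    by (rule gf_split)
  also have "gf (\<lambda>n \<pi>. ?Q n \<pi> \<and> \<pi> 1 = 1) =
      gf (\<lambda>n \<pi>. num_comp n \<pi> = 1 \<and> n = 1) * gf (\<lambda>n \<pi>. iar n \<pi> = r \<and> K (num_comp n \<pi>))"
  proof (rule gf_dsum)
    fix m k \<sigma> \<tau> assume *: "\<sigma> \<in> indecomposables m" "\<tau> \<in> separable_perms k"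
    have p: "\<sigma> permutes {1..m}" "\<tau> permutes {1..k}"
      using * by (simp_all add: indecomposables_def separable_permutes)
    show "?Q (m + k) (dsum m \<sigma> \<tau>) \<and> dsum m \<sigma> \<tau> 1 = 1 \<longleftrightarrow> m = 1 \<and> iar k \<tau> = r \<and> K (num_comp k \<tau>)"
      using first(1)[OF *(1), of \<tau>] p iar_dsum_1[of \<sigma> \<tau> k] dsum_num_comp[OF *(1)] by auto
  qed (simp add: iar_0)
  also have "gf (\<lambda>n \<pi>. num_comp n \<pi> = 1 \<and> n = 1) = fps_X"
    by (rule gf_trivial_indecomposable)
  also have "gf (\<lambda>n \<pi>. ?Q n \<pi> \<and> \<pi> 1 \<noteq> 1) =
      gf (\<lambda>n \<pi>. num_comp n \<pi> = 1 \<and> 2 \<le> n \<and> iar n \<pi> = Suc r) * gf (\<lambda>n \<pi>. K (num_comp n \<pi>))"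
  proof (rule gf_dsum)
    fix m k \<sigma> \<tau> assume *: "\<sigma> \<in> indecomposables m" "\<tau> \<in> separable_perms k"
    show "?Q (m + k) (dsum m \<sigma> \<tau>) \<and> dsum m \<sigma> \<tau> 1 \<noteq> 1 \<longleftrightarrow>
        (2 \<le> m \<and> iar m \<sigma> = Suc r) \<and> K (num_comp k \<tau>)"
      using first(1)[OF *(1), of \<tau>] first(2)[OF *(1)] iar_dsum_indecomposable[OF *(1), of k \<tau>] dsum_num_comp[OF *(1)] by auto
  qed (simp add: iar_0)
  also have "gf (\<lambda>n \<pi>. num_comp n \<pi> = 1 \<and> 2 \<le> n \<and> iar n \<pi> = Suc r) =
      indec_gf * gf (\<lambda>n \<pi>. 1 \<le> n \<and> iar n \<pi> = Suc r)"
    by (rule gf_nontrivial_indecomposable)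
  also have "gf (\<lambda>n \<pi>. 1 \<le> n \<and> iar n \<pi> = Suc r) = gf (\<lambda>n \<pi>. iar n \<pi> = Suc r)"
  proof (rule gf_cong)
    fix n and \<pi> :: "nat \<Rightarrow> nat"
    show "1 \<le> n \<and> iar n \<pi> = Suc r \<longleftrightarrow> iar n \<pi> = Suc r"
      using iar_eq_0_iff[of n \<pi>] by auto
  qed
  finally show ?thesis by simp
qed

text \<open>The recurrence and \<open>x = A (1 - T)\<close>, with \<open>T\<close> the series of the nonempty separable permutations,
  leave the common factor \<open>1 - T\<close>, which has constant term 1 and can be cancelled.\<close>

lemma gf_iar: "gf (\<lambda>n \<pi>. iar n \<pi> = r) = indec_gf ^ r"
proof (induction r)
  case 0
  show ?case by (simp add: iar_eq_0_iff gf_size_0)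
next
  case (Suc r)
  let ?F = "\<lambda>r. gf (\<lambda>n \<pi>. iar n \<pi> = r)" and ?T = "gf (\<lambda>n \<pi>. 1 \<le> n)"
  have "?F (Suc r) = fps_X * ?F r + indec_gf * ?F (Suc r) * gf (\<lambda>n \<pi>. True)"
    using gf_iar_Suc[of r "\<lambda>_. True"] by simp
  also have "\<dots> = fps_X * ?F r + ?F (Suc r) * ?T"
    by (simp add: gf_size_pos mult_ac)
  finally have "?F (Suc r) * (1 - ?T) = fps_X * ?F r"
    by (simp add: algebra_simps)
  also have "fps_X = indec_gf * (1 - ?T)"
    using indec_gf_eq by (simp add: algebra_simps)
  finally have "?F (Suc r) * (1 - ?T) = (indec_gf * ?F r) * (1 - ?T)"
    by (simp add: mult_ac)
  moreover have "(1 - ?T) $ 0 = 1"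
    by (simp add: gf_def)
  then have "1 - ?T \<noteq> 0"
    by (metis fps_zero_nth zero_neq_one)
  ultimately show ?case by (simp add: Suc.IH)
qed

text \<open>Apart from the empty permutation both statistics are positive; for positive values the recurrence has
  an inhomogeneous term that depends on the sum of the two values only.\<close>

lemma joint_gf_symmetric:
  "gf (\<lambda>n \<pi>. iar n \<pi> = r \<and> num_comp n \<pi> = c) = gf (\<lambda>n \<pi>. iar n \<pi> = c \<and> num_comp n \<pi> = r)"
proof (induction c arbitrary: r)
  case 0
  show ?case
  proof (rule gf_cong)
    fix n \<pi> assume "\<pi> \<in> separable_perms n"
    then show "iar n \<pi> = r \<and> num_comp n \<pi> = 0 \<longleftrightarrow> iar n \<pi> = 0 \<and> num_comp n \<pi> = r"
      using num_comp_eq_0_iff[of \<pi> n] iar_eq_0_iff[of n \<pi>] by auto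
  qed
next
  case (Suc c)
  have rec: "gf (\<lambda>n \<pi>. iar n \<pi> = Suc r \<and> num_comp n \<pi> = Suc c) =
      fps_X * gf (\<lambda>n \<pi>. iar n \<pi> = r \<and> num_comp n \<pi> = c) + indec_gf ^ (r + c + 2)" for r c
  proof -
    have "gf (\<lambda>n \<pi>. iar n \<pi> = Suc r \<and> num_comp n \<pi> = Suc c)
        = gf (\<lambda>n \<pi>. iar n \<pi> = Suc r \<and> num_comp n \<pi> - 1 = c)"
    proof (rule gf_cong)
      fix n \<pi> assume "\<pi> \<in> separable_perms n"
      then show "iar n \<pi> = Suc r \<and> num_comp n \<pi> = Suc c \<longleftrightarrow> iar n \<pi> = Suc r \<and> num_comp n \<pi> - 1 = c"
        using num_comp_eq_0_iff[of \<pi> n] iar_eq_0_iff[of n \<pi>] by auto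
    qed
    also have "\<dots> = fps_X * gf (\<lambda>n \<pi>. iar n \<pi> = r \<and> num_comp n \<pi> = c) +
        indec_gf * indec_gf ^ Suc r * indec_gf ^ c"
      by (simp only: gf_iar_Suc[of r "\<lambda>x. x = c"] gf_iar gf_num_comp[of c])
    finally show ?thesis by (simp add: power_add power2_eq_square mult_ac)
  qed
  show ?case
  proof (cases r)
    case 0
    show ?thesis unfolding 0
    proof (rule gf_cong)
      fix n \<pi> assume "\<pi> \<in> separable_perms n"
      then show "iar n \<pi> = 0 \<and> num_comp n \<pi> = Suc c \<longleftrightarrow> iar n \<pi> = Suc c \<and> num_comp n \<pi> = 0"
        using num_comp_eq_0_iff[of \<pi> n] iar_eq_0_iff[of n \<pi>] by auto
    qed
  next
    case (Suc r')
    then show ?thesis using Suc.IH[of r'] by (simp add: rec add_ac)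
  qed
qed

theorem corollary1p2:
  fixes n :: nat
  assumes "n \<ge> 1"
  shows "equidistributed_on (separable_perms n)
           (\<lambda>\<pi>. (num_comp n \<pi>, iar n \<pi>)) (\<lambda>\<pi>. (iar n \<pi>, num_comp n \<pi>))"
  unfolding equidistributed_on_def
proof
  fix v :: "nat \<times> nat"
  obtain a b where v: "v = (a, b)" by fastforce
  have "gf (\<lambda>n \<pi>. iar n \<pi> = b \<and> num_comp n \<pi> = a) $ n = gf (\<lambda>n \<pi>. iar n \<pi> = a \<and> num_comp n \<pi> = b) $ n"
    by (simp only: joint_gf_symmetric[of b a])
  then show "card {\<pi> \<in> separable_perms n. (num_comp n \<pi>, iar n \<pi>) = v} =
      card {\<pi> \<in> separable_perms n. (iar n \<pi>, num_comp n \<pi>) = v}"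
    by (simp add: gf_def v conj_commute)
qed

end
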